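(* A graph $G=(V,E)$ has an orientation containing no closed antidirected trail if and only if (i) $|E(H)|\le 2|V(H)|-1$ for all nonempty subgraphs $H$ of $G$, and (ii) $|E(H)|\le 2|V(H)|-2$ for all nonempty bipartite subgraphs $H$ of $G$. In particular, no graph with $n$ vertices and at least $2n$ edges, and no bipartite graph with $n$ vertices and at least $2n-1$ edges, has an orientation containing no closed antidirected trail.
   Context: Graphs are finite and loopless; parallel edges may occur. An orientation of $G$ replaces each edge by an arc joining its ends. In a walk (in the underlying graph) of a digraph an arc $vw$ is forward if traversed from $v$ to $w$ and backward if traversed from $w$ to $v$. A closed antidirected trail is a closed walk of even length with no repeated arc whose arcs alternate between forward and backward arcs. *)

theory Defs
  imports "Graph_Theory.Digraph"
begin

text \<open>Undirected graphs with named edges, so that parallel edges may occur; digraphs are the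
  (multi-)digraphs \<^typ>\<open>('v, 'e) pre_digraph\<close> of Graph_Theory. The null graph is allowed.\<close>

record ('v, 'e) multigraph =
  mverts :: "'v set"
  medges :: "'e set"
  mends :: "'e \<Rightarrow> 'v set"

locale finite_loopless_multigraph =
  fixes G :: "('v, 'e) multigraph"
  assumes finite_mverts: "finite (mverts G)"
    and finite_medges: "finite (medges G)"
    and mends_subset: "e \<in> medges G \<Longrightarrow> mends G e \<subseteq> mverts G"
    and card_mends: "e \<in> medges G \<Longrightarrow> card (mends G e) = 2"

definition msubgraph :: "('v, 'e) multigraph \<Rightarrow> ('v, 'e) multigraph \<Rightarrow> bool" where
  "msubgraph H G \<longleftrightarrow>
     mverts H \<subseteq> mverts G \<and> medges H \<subseteq> medges G \<and>
     (\<forall>e\<in>medges H. mends H e = mends G e \<and> mends H e \<subseteq> mverts H)"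

definition mbipartite :: "('v, 'e) multigraph \<Rightarrow> bool" where
  "mbipartite G \<longleftrightarrow>
     (\<exists>A B. A \<union> B = mverts G \<and> A \<inter> B = {} \<and>
        (\<forall>e\<in>medges G. \<exists>a\<in>A. \<exists>b\<in>B. mends G e = {a, b}))"

definition underlying :: "('v, 'e) pre_digraph \<Rightarrow> ('v, 'e) multigraph" where
  "underlying D = \<lparr>mverts = verts D, medges = arcs D, mends = (\<lambda>a. {tail D a, head D a})\<rparr>"

definition orientation :: "('v, 'e) pre_digraph \<Rightarrow> ('v, 'e) multigraph \<Rightarrow> bool" where
  "orientation D G \<longleftrightarrow>
     verts D = mverts G \<and> arcs D = medges G \<and>
     (\<forall>e\<in>medges G. mends G e = {tail D e, head D e})"

text \<open>A walk \<open>v\<^sub>0 e\<^sub>1 v\<^sub>1 \<dots> e\<^sub>k v\<^sub>k\<close> is given by its vertex list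
  \<open>vs = [v\<^sub>0, \<dots>, v\<^sub>k]\<close> and its edge list \<open>es = [e\<^sub>1, \<dots>, e\<^sub>k]\<close>.\<close>

definition mwalk :: "('v, 'e) multigraph \<Rightarrow> 'v list \<Rightarrow> 'e list \<Rightarrow> bool" where
  "mwalk G vs es \<longleftrightarrow>
     length vs = Suc (length es) \<and> set vs \<subseteq> mverts G \<and> set es \<subseteq> medges G \<and>
     (\<forall>i<length es. mends G (es ! i) = {vs ! i, vs ! Suc i})"

definition forward :: "('v, 'e) pre_digraph \<Rightarrow> 'v list \<Rightarrow> 'e list \<Rightarrow> nat \<Rightarrow> bool" where
  "forward D vs es i \<longleftrightarrow> tail D (es ! i) = vs ! i \<and> head D (es ! i) = vs ! Suc i"

definition backward :: "('v, 'e) pre_digraph \<Rightarrow> 'v list \<Rightarrow> 'e list \<Rightarrow> nat \<Rightarrow> bool" where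
  "backward D vs es i \<longleftrightarrow> head D (es ! i) = vs ! i \<and> tail D (es ! i) = vs ! Suc i"

text \<open>The trivial walk without arcs is excluded. Since the length is even, the first and the last
  arc also differ in direction, so the alternation is automatically cyclic.\<close>

definition closed_antidirected_trail ::
    "('v, 'e) pre_digraph \<Rightarrow> 'v list \<Rightarrow> 'e list \<Rightarrow> bool" where
  "closed_antidirected_trail D vs es \<longleftrightarrow>
     mwalk (underlying D) vs es \<and> es \<noteq> [] \<and> hd vs = last vs \<and>
     even (length es) \<and> distinct es \<and>
     (\<forall>i. Suc i < length es \<longrightarrow>
        (forward D vs es i \<and> backward D vs es (Suc i)) \<or>
        (backward D vs es i \<and> forward D vs es (Suc i)))"

text \<open>Here \<open>cat\<close> stands for closed antidirected trail.\<close>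

definition has_cat_free_orientation :: "('v, 'e) multigraph \<Rightarrow> bool" where
  "has_cat_free_orientation G \<longleftrightarrow>
     (\<exists>D. orientation D G \<and> (\<nexists>vs es. closed_antidirected_trail D vs es))"

end

theory Submission
  imports Defs
begin

text \<open>Replace each vertex \<open>v\<close> by two copies \<open>(v, True)\<close> and \<open>(v, False)\<close>, and let an arc \<open>vw\<close> become an
  edge from \<open>(v, True)\<close> to \<open>(w, False)\<close>. Closed antidirected trails of the digraph are closed trails
  of this double graph, so an orientation is good iff its double graph is a forest. A forest on
  \<open>2n\<close> vertices has at most \<open>2n - 1\<close> edges, and at most \<open>2n - 2\<close> if the graph is bipartite,
  since then the double graph is disconnected. Conversely, every edge of \<open>G\<close> has two possible
  lifts, and a good orientation is a transversal of these pairs that is independent in the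
  graphic matroid of the double cover. Rado's theorem gives one as soon as the lifts of every
  edge set \<open>J\<close> have rank at least \<open>|J|\<close>; since the double cover of a component is connected,
  or splits into two copies if the component is bipartite, this is what (i) and (ii) say.\<close>

section \<open>Components of an edge set\<close>

text \<open>Edges are indices whose ends are given by two maps, so parallel edges stay distinct and
  the same notion serves both for the double graph of a digraph and for the double cover of a
  graph.\<close>

definition conn :: "('x \<Rightarrow> 'w) \<Rightarrow> ('x \<Rightarrow> 'w) \<Rightarrow> 'x set \<Rightarrow> ('w \<times> 'w) set" where
  "conn p q X = (\<Union>x\<in>X. {(p x, q x), (q x, p x)})\<^sup>*"

text \<open>The vertex set \<open>W\<close> is listed explicitly so that isolated vertices count as
  components. If all ends lie in \<open>W\<close>, then \<open>card W - card (comps p q W X)\<close>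
  is the rank of \<open>X\<close> in the graphic matroid.\<close>

definition comps :: "('x \<Rightarrow> 'w) \<Rightarrow> ('x \<Rightarrow> 'w) \<Rightarrow> 'w set \<Rightarrow> 'x set \<Rightarrow> 'w set set" where
  "comps p q W X = (\<lambda>w. conn p q X `` {w}) ` W"

lemma conn_refl [simp]: "(a, a) \<in> conn p q X"
  by (simp add: conn_def)

lemma conn_sym: "(a, b) \<in> conn p q X \<Longrightarrow> (b, a) \<in> conn p q X"
  unfolding conn_def by (rule symD[OF sym_rtrancl]) (auto simp: sym_def)

lemma conn_trans: "(a, b) \<in> conn p q X \<Longrightarrow> (b, c) \<in> conn p q X \<Longrightarrow> (a, c) \<in> conn p q X"
  unfolding conn_def by (rule rtrancl_trans)

lemma conn_edge: "x \<in> X \<Longrightarrow> (p x, q x) \<in> conn p q X"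
  unfolding conn_def by (rule r_into_rtrancl) blast

lemma conn_mono: "X \<subseteq> Y \<Longrightarrow> conn p q X \<subseteq> conn p q Y"
  unfolding conn_def by (rule rtrancl_mono) blast

lemma conn_image: "conn p q (s ` X) = conn (p \<circ> s) (q \<circ> s) X"
  by (simp add: conn_def)

text \<open>A set that no edge leaves is a union of components. This keeps components inside the
  vertex set and separates the two copies of a vertex in the bipartite case.\<close>

lemma conn_invariant:
  assumes "(a, b) \<in> conn p q X" and "\<And>x. x \<in> X \<Longrightarrow> p x \<in> S \<longleftrightarrow> q x \<in> S"
  shows "a \<in> S \<longleftrightarrow> b \<in> S"
  using assms(1) unfolding conn_def by induction (use assms(2) in auto)

text \<open>Applying \<open>f\<close> to a walk edge by edge gives a walk again. The intended
  \<open>f\<close> exchanges the two copies of every vertex of the double cover.\<close>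

lemma conn_automorphism:
  assumes "(a, b) \<in> conn p q X"
    and "\<And>x. x \<in> X \<Longrightarrow> \<exists>y\<in>X. {f (p x), f (q x)} = {p y, q y}"
  shows "(f a, f b) \<in> conn p q X"
  using assms(1)[unfolded conn_def]
proof induction
  case (step b c)
  then obtain x where x: "x \<in> X" "(b, c) = (p x, q x) \<or> (b, c) = (q x, p x)" by auto
  obtain y where "y \<in> X" "{f (p x), f (q x)} = {p y, q y}" using assms(2) x(1) by blast
  then have "(f b, f c) \<in> conn p q X"
    using x(2) conn_edge[of y X p q] conn_sym[OF conn_edge[of y X p q]]
    by (auto simp: doubleton_eq_iff)
  then show ?case using step.IH conn_trans by metis
qed simp

lemma conn_class_eq: "(a, b) \<in> conn p q X \<Longrightarrow> conn p q X `` {a} = conn p q X `` {b}"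
  by (auto intro: conn_trans conn_sym)

lemma conn_class_eq_iff: "conn p q X `` {a} = conn p q X `` {b} \<longleftrightarrow> (a, b) \<in> conn p q X"
proof
  assume "conn p q X `` {a} = conn p q X `` {b}"
  moreover have "b \<in> conn p q X `` {b}" by simp
  ultimately show "(a, b) \<in> conn p q X" by blast
qed (rule conn_class_eq)

text \<open>A walk can be shortened so that it uses the new edge at most once, in one of its two
  directions.\<close>

lemma conn_insert:
  "(a, b) \<in> conn p q (insert x X) \<longleftrightarrow> (a, b) \<in> conn p q X \<or>
     (a, p x) \<in> conn p q X \<and> (q x, b) \<in> conn p q X \<or>
     (a, q x) \<in> conn p q X \<and> (p x, b) \<in> conn p q X"
proof -
  let ?R = "\<Union>x\<in>X. {(p x, q x), (q x, p x)}"
  have "(\<Union>y\<in>insert x X. {(p y, q y), (q y, p y)}) = insert (p x, q x) (insert (q x, p x) ?R)"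
    by auto
  then have "conn p q (insert x X) = (insert (p x, q x) (insert (q x, p x) ?R))\<^sup>*"
    by (simp add: conn_def)
  then show ?thesis
    unfolding conn_def rtrancl_insert by (auto intro: rtrancl_trans)
qed

section \<open>The number of components when one edge is added\<close>

lemma comps_insert_connected:
  assumes "(p x, q x) \<in> conn p q X"
  shows "comps p q W (insert x X) = comps p q W X"
proof -
  have "(a, b) \<in> conn p q (insert x X) \<longleftrightarrow> (a, b) \<in> conn p q X" for a b
    unfolding conn_insert by (meson assms conn_sym conn_trans)
  then have "conn p q (insert x X) = conn p q X" by auto
  then show ?thesis by (simp add: comps_def)
qed

text \<open>The new edge merges exactly the classes \<open>?A\<close> and \<open>?B\<close> of its
  two ends and leaves every other class alone.\<close>

lemma card_comps_insert_disconnected: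
  assumes W: "finite W" "p x \<in> W" "q x \<in> W" and x: "(p x, q x) \<notin> conn p q X"
  shows "card (comps p q W X) = Suc (card (comps p q W (insert x X)))"
proof -
  let ?A = "conn p q X `` {p x}" and ?B = "conn p q X `` {q x}"
  let ?C = "comps p q W X"
  have cls: "conn p q (insert x X) `` {w} =
    (if w \<in> ?A \<union> ?B then ?A \<union> ?B else conn p q X `` {w})" for w
  proof -
    have *: "(w, v) \<in> conn p q (insert x X) \<longleftrightarrow>
      (if w \<in> ?A \<union> ?B then v \<in> ?A \<union> ?B else (w, v) \<in> conn p q X)" for v
      unfolding conn_insert
      by (simp; meson conn_sym conn_trans)
    show ?thesis
    proof (cases "w \<in> ?A \<union> ?B")
      case True
      then show ?thesis using * by (intro set_eqI) (simp only: Image_singleton_iff if_True)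
    next
      case False
      then show ?thesis using * by (intro set_eqI) (simp only: Image_singleton_iff if_False)
    qed
  qed
  have AB: "?A \<in> ?C" "?B \<in> ?C" "?A \<noteq> ?B"
    using W x by (auto simp: comps_def conn_class_eq_iff)
  have split: "w \<in> ?A \<union> ?B \<longleftrightarrow> conn p q X `` {w} = ?A \<or> conn p q X `` {w} = ?B" for w
    unfolding conn_class_eq_iff by (auto intro: conn_sym)
  have "comps p q W (insert x X) = insert (?A \<union> ?B) (?C - {?A, ?B})"
  proof (intro set_eqI iffI)
    fix K assume "K \<in> comps p q W (insert x X)"
    then obtain w where w: "w \<in> W" "K = conn p q (insert x X) `` {w}" by (auto simp: comps_def)
    show "K \<in> insert (?A \<union> ?B) (?C - {?A, ?B})"
    proof (cases "w \<in> ?A \<union> ?B")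
      case True
      then show ?thesis using w(2) cls by simp
    next
      case False
      then have "K = conn p q X `` {w}" using w(2) cls by simp
      moreover from this have "K \<noteq> ?A" "K \<noteq> ?B" using False split[of w] by blast+
      ultimately show ?thesis using w(1) by (simp add: comps_def)
    qed
  next
    fix K assume "K \<in> insert (?A \<union> ?B) (?C - {?A, ?B})"
    then consider "K = ?A \<union> ?B" | "K \<in> ?C" "K \<noteq> ?A" "K \<noteq> ?B" by blast
    then show "K \<in> comps p q W (insert x X)"
    proof cases
      case 1
      then have "K = conn p q (insert x X) `` {p x}" using cls[of "p x"] by simp
      then show ?thesis using W(2) by (simp add: comps_def)
    next
      case 2
      then obtain w where w: "w \<in> W" "K = conn p q X `` {w}" by (auto simp: comps_def)
      then have "K = conn p q (insert x X) `` {w}" using cls[of w] split[of w] 2 by simp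
      then show ?thesis using w(1) by (simp add: comps_def)
    qed
  qed
  \<comment> \<open>The merged class is new, so two classes disappear and exactly one is
    gained.\<close>
  moreover have "?A \<union> ?B \<notin> ?C - {?A, ?B}"
  proof
    assume "?A \<union> ?B \<in> ?C - {?A, ?B}"
    then obtain w where w: "conn p q X `` {w} = ?A \<union> ?B" "?A \<union> ?B \<noteq> ?A"
      by (auto simp: comps_def)
    then have "p x \<in> conn p q X `` {w}" by simp
    then have "conn p q X `` {w} = ?A" by (auto simp: conn_class_eq_iff)
    then show False using w by simp
  qed
  moreover have "finite ?C" using W by (simp add: comps_def)
  moreover have "card (?C - {?A, ?B}) = card ?C - 2"
    using AB by (simp add: card_Diff_subset)
  moreover have "card ?C \<ge> 2"
    using card_mono[OF \<open>finite ?C\<close>, of "{?A, ?B}"] AB by simp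
  ultimately show ?thesis by simp
qed

section \<open>Monotonicity and supermodularity of the number of components\<close>

lemma finite_comps: "finite W \<Longrightarrow> finite (comps p q W X)"
  by (simp add: comps_def)

lemma card_comps_le: "finite W \<Longrightarrow> card (comps p q W X) \<le> card W"
  by (simp add: comps_def card_image_le)

lemma comps_empty: "card (comps p q W {}) = card W"
proof -
  have "inj_on (\<lambda>w. conn p q {} `` {w}) W" by (simp add: inj_on_def conn_def)
  then show ?thesis unfolding comps_def by (rule card_image)
qed

lemma card_comps_insert_le:
  assumes "finite W" "p x \<in> W" "q x \<in> W"
  shows "card (comps p q W (insert x X)) \<le> card (comps p q W X) \<and>
    card (comps p q W X) \<le> Suc (card (comps p q W (insert x X)))"
  using card_comps_insert_disconnected[where p = p and q = q, OF assms] comps_insert_connected[of p x q X W]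
  by (cases "(p x, q x) \<in> conn p q X") simp_all

lemma card_comps_antimono:
  assumes W: "finite W" "\<And>x. x \<in> Y \<Longrightarrow> p x \<in> W \<and> q x \<in> W"
    and "finite Y" "X \<subseteq> Y"
  shows "card (comps p q W Y) \<le> card (comps p q W X)"
proof -
  have "card (comps p q W (X \<union> Z)) \<le> card (comps p q W X)" if "finite Z" "Z \<subseteq> Y" for Z
    using that
  proof induction
    case (insert z Z)
    then show ?case using card_comps_insert_le[OF W(1), of p z q "X \<union> Z"] W(2) by fastforce
  qed simp
  from this[OF \<open>finite Y\<close>] show ?thesis using \<open>X \<subseteq> Y\<close> by (simp add: Un_absorb1)
qed

text \<open>This is submodularity of the graphic rank. The elements of \<open>Y\<close> are added
  one at a time to both \<open>X \<inter> Y\<close> and \<open>X\<close>; an edge that merges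
  nothing in the smaller set merges nothing in the larger one, so the count drops at least as much
  in the smaller set.\<close>

lemma card_comps_supermodular:
  assumes W: "finite W" "\<And>x. x \<in> Y \<Longrightarrow> p x \<in> W \<and> q x \<in> W"
    and "finite Y"
  shows "card (comps p q W X) + card (comps p q W Y) \<le>
    card (comps p q W (X \<union> Y)) + card (comps p q W (X \<inter> Y))"
proof -
  let ?c = "\<lambda>X. card (comps p q W X)"
  have "?c X + ?c (X \<inter> Y \<union> Z) \<le> ?c (X \<union> Z) + ?c (X \<inter> Y)" if "finite Z" "Z \<subseteq> Y" for Z
    using that
  proof induction
    case (insert z Z)
    have z: "p z \<in> W" "q z \<in> W" using W(2) insert.prems by auto
    have IH: "?c X + ?c (X \<inter> Y \<union> Z) \<le> ?c (X \<union> Z) + ?c (X \<inter> Y)" using insert by simp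
    have "?c (X \<inter> Y \<union> insert z Z) + ?c (X \<union> Z) \<le> ?c (X \<union> insert z Z) + ?c (X \<inter> Y \<union> Z)"
    proof (cases "(p z, q z) \<in> conn p q (X \<inter> Y \<union> Z)")
      case True
      then have "(p z, q z) \<in> conn p q (X \<union> Z)"
        using conn_mono[of "X \<inter> Y \<union> Z" "X \<union> Z" p q] by blast
      then show ?thesis using True by (simp add: comps_insert_connected)
    next
      case False
      then show ?thesis
        using card_comps_insert_disconnected[where p = p and q = q, OF W(1) z False]
          card_comps_insert_le[where p = p and q = q, OF W(1) z, of "X \<union> Z"]
        by simp
    qed
    then show ?case using IH by linarith
  qed simp
  from this[OF \<open>finite Y\<close>] show ?thesis by (simp add: Un_absorb1)
qed

section \<open>Forests and partitions into components\<close>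

lemma card_comps_add_card_ge:
  assumes W: "finite W" "\<And>x. x \<in> X \<Longrightarrow> p x \<in> W \<and> q x \<in> W" and "finite X"
  shows "card W \<le> card (comps p q W X) + card X"
  using assms(3) W(2)
proof induction
  case (insert x X)
  then have "card (comps p q W X) \<le> Suc (card (comps p q W (insert x X)))"
    using card_comps_insert_le[OF W(1), of p x q X] by blast
  with insert show ?case by fastforce
qed (simp add: comps_empty)

text \<open>When a forest is built edge by edge, every edge joins two different components, so every
  edge lowers their number by one.\<close>

lemma card_comps_acyclic:
  assumes W: "finite W" "\<And>x. x \<in> X \<Longrightarrow> p x \<in> W \<and> q x \<in> W" and "finite X"
    and acyclic: "\<And>x. x \<in> X \<Longrightarrow> (p x, q x) \<notin> conn p q (X - {x})"
  shows "card (comps p q W X) + card X = card W"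
proof -
  have "card (comps p q W Y) + card Y = card W" if "finite Y" "Y \<subseteq> X" for Y
    using that
  proof induction
    case (insert y Y)
    then have "conn p q Y \<subseteq> conn p q (X - {y})" by (intro conn_mono) auto
    then have "(p y, q y) \<notin> conn p q Y" using acyclic[of y] insert.prems by blast
    then have "card (comps p q W Y) = Suc (card (comps p q W (insert y Y)))"
      using card_comps_insert_disconnected[OF W(1), of p y q Y] W(2) insert.prems by blast
    then show ?case using insert by simp
  qed (simp add: comps_empty)
  then show ?thesis using assms(3) by blast
qed

text \<open>An edge on a cycle can be deleted without changing the components, but then fewer edges
  than needed would bring the number of components down from \<open>card W\<close>.\<close>

lemma acyclic_if_card_comps:
  assumes W: "finite W" "\<And>x. x \<in> X \<Longrightarrow> p x \<in> W \<and> q x \<in> W" and X: "finite X"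
    and le: "card (comps p q W X) + card X \<le> card W" and "x \<in> X"
  shows "(p x, q x) \<notin> conn p q (X - {x})"
proof
  assume "(p x, q x) \<in> conn p q (X - {x})"
  then have "comps p q W X = comps p q W (X - {x})"
    using comps_insert_connected[of p x q "X - {x}" W] \<open>x \<in> X\<close> by (simp add: insert_absorb)
  moreover have "card W \<le> card (comps p q W (X - {x})) + card (X - {x})"
    using card_comps_add_card_ge[OF W(1), of "X - {x}" p q] W(2) X by simp
  moreover have "card (X - {x}) < card X" using X \<open>x \<in> X\<close> by (rule card_Diff1_less)
  ultimately show False using le by simp
qed

lemma sum_card_comps:
  assumes "finite W" "\<And>x. x \<in> X \<Longrightarrow> p x \<in> W \<and> q x \<in> W"
  shows "(\<Sum>K\<in>comps p q W X. card K) = card W"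
proof -
  have sub: "K \<subseteq> W" if "K \<in> comps p q W X" for K
    using that conn_invariant[of _ _ p q X W] assms(2) unfolding comps_def by blast
  have "(\<Sum>K\<in>comps p q W X. card K) = card (\<Union> (comps p q W X))"
  proof (rule card_Union_disjoint[symmetric])
    show "pairwise disjnt (comps p q W X)"
    proof (rule pairwiseI)
      fix K L assume "K \<in> comps p q W X" "L \<in> comps p q W X" "K \<noteq> L"
      then obtain a b where ab: "K = conn p q X `` {a}" "L = conn p q X `` {b}"
        by (auto simp: comps_def)
      with \<open>K \<noteq> L\<close> have "(a, b) \<notin> conn p q X" by (metis conn_class_eq)
      with ab show "disjnt K L" unfolding disjnt_iff by (metis Image_singleton_iff conn_sym conn_trans)
    qed
    show "finite K" if "K \<in> comps p q W X" for K
      using sub[OF that] assms(1) finite_subset by blast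
  qed
  also have "\<Union> (comps p q W X) = W"
    using sub by (auto simp: comps_def)
  finally show ?thesis .
qed

section \<open>Rado's theorem\<close>

text \<open>The fibres of \<open>f\<close> are the sets from which a transversal is chosen, and
  \<open>r\<close> may be any monotone submodular function. The ground set is shrunk: if a fibre
  contains two elements, one of them can be deleted without violating the Hall condition, since two
  violations would contradict submodularity.\<close>

theorem rado:
  fixes f :: "'x \<Rightarrow> 'e" and r :: "'x set \<Rightarrow> nat"
  assumes "finite A" "f ` A = E"
    and mono: "\<And>X Y. X \<subseteq> Y \<Longrightarrow> Y \<subseteq> A \<Longrightarrow> r X \<le> r Y"
    and submod: "\<And>X Y. X \<subseteq> A \<Longrightarrow> Y \<subseteq> A \<Longrightarrow> r (X \<union> Y) + r (X \<inter> Y) \<le> r X + r Y"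
    and hall: "\<And>J. J \<subseteq> E \<Longrightarrow> card J \<le> r {x \<in> A. f x \<in> J}"
  shows "\<exists>T\<subseteq>A. bij_betw f T E \<and> card E \<le> r T"
  using assms
proof (induction A rule: finite_psubset_induct)
  case (psubset A)
  show ?case
  proof (cases "inj_on f A")
    case True
    have "{x \<in> A. f x \<in> E} = A" using psubset.prems(1) by blast
    then have "card E \<le> r A" using psubset.prems(4)[of E] by simp
    then show ?thesis using True psubset.prems(1) by (auto simp: bij_betw_def)
  next
    case False
    then obtain x y where xy: "x \<in> A" "y \<in> A" "x \<noteq> y" "f x = f y" by (auto simp: inj_on_def)
    have finE: "finite E" using psubset.hyps psubset.prems(1) by blast
    show ?thesis
    proof (rule ccontr)
      assume contra: "\<not> ?thesis"
      \<comment> \<open>Deleting \<open>z\<close> keeps \<open>f\<close> surjective because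
        \<open>z'\<close> lies in the same fibre. If the Hall condition survived as well, induction
        would give the transversal that \<open>contra\<close> denies.\<close>
      have step: "\<exists>J\<subseteq>E. r {u \<in> A - {z}. f u \<in> J} < card J"
        if z: "z \<in> A" "z' \<in> A" "z' \<noteq> z" "f z' = f z" for z z'
      proof (rule ccontr)
        assume "\<not> ?thesis"
        then have hall': "card J \<le> r {u \<in> A - {z}. f u \<in> J}" if "J \<subseteq> E" for J
          using that by (meson not_le)
        have "f ` (A - {z}) = E" using psubset.prems(1) z
          by (metis (no_types, lifting) image_insert insertCI insert_Diff insert_absorb insertE)
        then have "\<exists>T\<subseteq>A - {z}. bij_betw f T E \<and> card E \<le> r T"
          using z(1) hall' by (intro psubset.IH psubset.prems(2,3)) auto
        then show False using contra by blast
      qed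
      obtain I where I: "I \<subseteq> E" "r {u \<in> A - {x}. f u \<in> I} < card I"
        using step[OF xy(1,2) xy(3,4)[symmetric]] by blast
      obtain J where J: "J \<subseteq> E" "r {u \<in> A - {y}. f u \<in> J} < card J"
        using step[OF xy(2,1,3,4)] by blast
      let ?X = "{u \<in> A - {x}. f u \<in> I}" and ?Y = "{u \<in> A - {y}. f u \<in> J}"
      \<comment> \<open>If \<open>f x\<close> were outside \<open>I\<close>, deleting
        \<open>x\<close> would not touch the fibres over \<open>I\<close>, so the Hall condition
        could not fail there. The same holds for \<open>y\<close> and \<open>J\<close>.\<close>
      have fx: "f x \<in> I" "f x \<in> J"
      proof -
        show "f x \<in> I"
        proof (rule ccontr)
          assume "f x \<notin> I"
          then have "?X = {u \<in> A. f u \<in> I}" by auto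
          then show False using I psubset.prems(4)[of I] by simp
        qed
        show "f x \<in> J"
        proof (rule ccontr)
          assume "f x \<notin> J"
          then have "?Y = {u \<in> A. f u \<in> J}" using xy by auto
          then show False using J psubset.prems(4)[of J] by simp
        qed
      qed
      have "?X \<union> ?Y = {u \<in> A. f u \<in> I \<union> J}" using xy fx by auto
      then have "card (I \<union> J) \<le> r (?X \<union> ?Y)" using psubset.prems(4)[of "I \<union> J"] I J by simp
      \<comment> \<open>The intersection misses both \<open>x\<close> and \<open>y\<close>, so the
        fibre over \<open>f x\<close> is given up; this costs one element of
        \<open>I \<inter> J\<close>.\<close>
      moreover have "card (I \<inter> J - {f x}) \<le> r (?X \<inter> ?Y)"
      proof -
        have "card (I \<inter> J - {f x}) \<le> r {u \<in> A. f u \<in> I \<inter> J - {f x}}"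
          using I by (intro psubset.prems(4)) auto
        also have "\<dots> \<le> r (?X \<inter> ?Y)" using xy by (intro psubset.prems(2)) auto
        finally show ?thesis .
      qed
      moreover have "r (?X \<union> ?Y) + r (?X \<inter> ?Y) \<le> r ?X + r ?Y"
        by (intro psubset.prems(3)) auto
      moreover have "card (I \<union> J) + card (I \<inter> J) = card I + card J"
        using card_Un_Int[of I J] finite_subset[OF _ finE] I(1) J(1) by simp
      moreover have "card (I \<inter> J) = Suc (card (I \<inter> J - {f x}))"
        using fx finite_subset[OF I(1) finE] by (metis IntI card_Suc_Diff1 finite_Int)
      \<comment> \<open>The two lower bounds add up to \<open>card I + card J - 1\<close>, while the
        two violations bound the right-hand side by \<open>card I + card J - 2\<close>.\<close>
      ultimately show False using I(2) J(2) by linarith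
    qed
  qed
qed

section \<open>Paths\<close>

definition edge_path :: "('x \<Rightarrow> 'w) \<Rightarrow> ('x \<Rightarrow> 'w) \<Rightarrow> 'w list \<Rightarrow> 'x list \<Rightarrow> bool" where
  "edge_path p q ws xs \<longleftrightarrow> length ws = Suc (length xs) \<and> distinct ws \<and>
     (\<forall>i<length xs. {p (xs ! i), q (xs ! i)} = {ws ! i, ws ! Suc i})"

lemma edge_path_Cons:
  assumes "edge_path p q (b # ws) xs" "{p x, q x} = {a, b}" "a \<notin> set (b # ws)"
  shows "edge_path p q (a # b # ws) (x # xs)"
proof -
  have "{p ((x # xs) ! i), q ((x # xs) ! i)} = {(a # b # ws) ! i, (a # b # ws) ! Suc i}"
    if "i < length (x # xs)" for i
    using that assms(1,2) by (cases i) (auto simp: edge_path_def)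
  then show ?thesis using assms(1,3) by (simp add: edge_path_def)
qed

text \<open>If a vertex to be put in front of a path is already on it, the part of the path before
  that vertex is dropped. This keeps the vertices distinct.\<close>

lemma edge_path_truncate:
  assumes path: "edge_path p q ws xs" and "a \<in> set ws"
  shows "\<exists>ws' xs'. edge_path p q (a # ws') xs' \<and> last (a # ws') = last ws \<and> set xs' \<subseteq> set xs"
proof -
  obtain k where k: "k < length ws" "ws ! k = a" using assms(2) by (auto simp: in_set_conv_nth)
  have drop: "drop k ws = a # drop (Suc k) ws" using Cons_nth_drop_Suc[OF k(1)] k(2) by simp
  have "edge_path p q (drop k ws) (drop k xs)"
    using path k(1) by (auto simp: edge_path_def)
  then have "edge_path p q (a # drop (Suc k) ws) (drop k xs)" by (simp only: drop)
  moreover have "last (a # drop (Suc k) ws) = last ws"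
    using last_drop[OF k(1)] by (simp only: drop)
  ultimately show ?thesis using set_drop_subset by fast
qed

text \<open>An edge used twice would have the same ends at both places, so the first end of its
  earlier use would reappear later among the distinct vertices.\<close>

lemma edge_path_distinct:
  assumes "edge_path p q ws xs"
  shows "distinct xs"
proof -
  have "xs ! i \<noteq> xs ! j" if "i < j" "j < length xs" for i j
  proof
    assume "xs ! i = xs ! j"
    moreover have "{p (xs ! i), q (xs ! i)} = {ws ! i, ws ! Suc i}"
      "{p (xs ! j), q (xs ! j)} = {ws ! j, ws ! Suc j}"
      using assms that by (auto simp: edge_path_def)
    ultimately have "ws ! i \<in> {ws ! j, ws ! Suc j}" by (metis insertI1)
    moreover have "ws ! i \<noteq> ws ! j" "ws ! i \<noteq> ws ! Suc j"
      using assms that by (auto simp: edge_path_def nth_eq_iff_index_eq)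
    ultimately show False by simp
  qed
  then show ?thesis by (metis distinct_conv_nth nat_neq_iff)
qed

lemma conn_imp_edge_path:
  assumes "(a, b) \<in> conn p q X"
  shows "\<exists>ws xs. edge_path p q (a # ws) xs \<and> last (a # ws) = b \<and> set xs \<subseteq> X"
  using assms[unfolded conn_def]
proof (induction rule: converse_rtrancl_induct)
  case base
  then show ?case by (intro exI[of _ "[]"]) (simp add: edge_path_def)
next
  case (step a c)
  then obtain x ws xs where x: "x \<in> X" "{p x, q x} = {a, c}"
    and path: "edge_path p q (c # ws) xs" "last (c # ws) = b" "set xs \<subseteq> X" by blast
  show ?case
  proof (cases "a \<in> set (c # ws)")
    case True
    then show ?thesis using edge_path_truncate[OF path(1) True] path(2,3) order_trans by metis
  next
    case False
    have "edge_path p q (a # c # ws) (x # xs)" by (rule edge_path_Cons[OF path(1) x(2) False])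
    moreover have "last (a # c # ws) = b" "set (x # xs) \<subseteq> X" using path x by auto
    ultimately show ?thesis by blast
  qed
qed

text \<open>A path from \<open>p e\<close> to \<open>q e\<close> avoiding \<open>e\<close> is closed
  up by \<open>e\<close> itself. The conclusion records that \<open>e\<close> comes last, traversed
  from \<open>q e\<close> to \<open>p e\<close>; the parity argument for the length depends on
  this.\<close>

lemma conn_imp_closed_trail:
  assumes "e \<in> X" "(p e, q e) \<in> conn p q (X - {e})"
  obtains ws xs where "length ws = Suc (length xs)" "ws ! 0 = p e" "last ws = p e"
    "xs \<noteq> []" "ws ! (length xs - 1) = q e" "set xs \<subseteq> X" "distinct xs"
    "\<And>i. i < length xs \<Longrightarrow> {p (xs ! i), q (xs ! i)} = {ws ! i, ws ! Suc i}"
proof -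
  obtain ws xs where path: "edge_path p q (p e # ws) xs" "last (p e # ws) = q e" "set xs \<subseteq> X - {e}"
    using conn_imp_edge_path[OF assms(2)] by blast
  let ?ws = "p e # ws" and ?xs = "xs @ [e]"
  have len: "length ?ws = Suc (length xs)" using path(1) by (simp add: edge_path_def)
  have last: "?ws ! length xs = q e"
    using path(2) len by (metis diff_Suc_1 last_conv_nth list.discI)
  have *: "{p (?xs ! i), q (?xs ! i)} = {(?ws @ [p e]) ! i, (?ws @ [p e]) ! Suc i}"
    if "i < length ?xs" for i
  proof (cases "i = length xs")
    case True
    have "(?ws @ [p e]) ! i = q e" using True last len by (metis lessI nth_append)
    moreover have "(?ws @ [p e]) ! Suc i = p e" using True len by (metis nth_append_length)
    ultimately show ?thesis using True by auto
  next
    case False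
    then have i: "i < length xs" using that by simp
    have "(?ws @ [p e]) ! i = ?ws ! i" "(?ws @ [p e]) ! Suc i = ?ws ! Suc i"
      using i len by (metis Suc_less_eq less_SucI nth_append)+
    then show ?thesis using path(1) i by (simp add: edge_path_def nth_append)
  qed
  show thesis
  proof (rule that[of "?ws @ [p e]" ?xs])
    show "(?ws @ [p e]) ! (length ?xs - 1) = q e"
      using last len by (metis diff_Suc_1 length_append_singleton lessI nth_append)
    show "{p (?xs ! i), q (?xs ! i)} = {(?ws @ [p e]) ! i, (?ws @ [p e]) ! Suc i}"
      if "i < length ?xs" for i by (rule *[OF that])
  qed (use path edge_path_distinct[OF path(1)] len assms(1) in auto)
qed

section \<open>The double graph of a digraph\<close>

definition src :: "('v, 'e) pre_digraph \<Rightarrow> 'e \<Rightarrow> 'v \<times> bool" where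
  "src D e = (tail D e, True)"

definition tgt :: "('v, 'e) pre_digraph \<Rightarrow> 'e \<Rightarrow> 'v \<times> bool" where
  "tgt D e = (head D e, False)"

text \<open>Every edge of the double graph joins a copy tagged \<open>True\<close> to one tagged
  \<open>False\<close>, so tags alternate along a closed trail. An arc left from its
  \<open>True\<close> end is traversed forward, and one left from its \<open>False\<close> end
  backward; forgetting the tags therefore gives alternating directions.\<close>

lemma closed_antidirected_trail_if_cycle:
  assumes ends: "\<And>e. e \<in> arcs D \<Longrightarrow> tail D e \<in> verts D \<and> head D e \<in> verts D"
    and e: "e \<in> arcs D" "(src D e, tgt D e) \<in> conn (src D) (tgt D) (arcs D - {e})"
  shows "\<exists>vs es. closed_antidirected_trail D vs es"
proof -
  obtain ws xs where ws: "length ws = Suc (length xs)" "ws ! 0 = src D e" "last ws = src D e"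
    and xs: "xs \<noteq> []" "ws ! (length xs - 1) = tgt D e" "set xs \<subseteq> arcs D" "distinct xs"
    and adj: "\<And>i. i < length xs \<Longrightarrow> {src D (xs ! i), tgt D (xs ! i)} = {ws ! i, ws ! Suc i}"
    using conn_imp_closed_trail[OF e] by metis
  have alt: "snd (ws ! i) = even i" if "i \<le> length xs" for i
    using that
  proof (induction i)
    case (Suc i)
    then have "{src D (xs ! i), tgt D (xs ! i)} = {ws ! i, ws ! Suc i}" by (intro adj) simp
    then have "snd (ws ! Suc i) \<longleftrightarrow> \<not> snd (ws ! i)"
      unfolding doubleton_eq_iff src_def tgt_def by (metis snd_conv)
    then show ?case using Suc by simp
  qed (simp add: ws src_def)
  \<comment> \<open>The vertex before the last is \<open>tgt D e\<close>, which is tagged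
    \<open>False\<close>, so its index \<open>length xs - 1\<close> is odd.\<close>
  have "even (length xs)"
    using alt[of "length xs - 1"] xs(1,2) by (auto simp: tgt_def)
  have fw: "forward D (map fst ws) xs i" if "i < length xs" "even i" for i
  proof -
    have "{(tail D (xs ! i), True), (head D (xs ! i), False)} = {ws ! i, ws ! Suc i}" "snd (ws ! i) = even i"
      using adj[of i] alt[of i] that(1) by (auto simp: src_def tgt_def)
    then have "(tail D (xs ! i), True) = ws ! i" "(head D (xs ! i), False) = ws ! Suc i"
      unfolding doubleton_eq_iff using that(2) by (metis snd_conv)+
    then have "tail D (xs ! i) = fst (ws ! i)" "head D (xs ! i) = fst (ws ! Suc i)"
      by (metis fst_conv)+
    then show ?thesis using that(1) ws(1) by (simp add: forward_def)
  qed
  have bw: "backward D (map fst ws) xs i" if "i < length xs" "odd i" for i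
  proof -
    have "{(tail D (xs ! i), True), (head D (xs ! i), False)} = {ws ! i, ws ! Suc i}" "snd (ws ! i) = even i"
      using adj[of i] alt[of i] that(1) by (auto simp: src_def tgt_def)
    then have "(tail D (xs ! i), True) = ws ! Suc i" "(head D (xs ! i), False) = ws ! i"
      unfolding doubleton_eq_iff using that(2) by (metis snd_conv)+
    then have "tail D (xs ! i) = fst (ws ! Suc i)" "head D (xs ! i) = fst (ws ! i)"
      by (metis fst_conv)+
    then show ?thesis using that(1) ws(1) by (simp add: backward_def)
  qed
  have "fst (ws ! i) \<in> verts D" if "i < length ws" for i
  proof (cases "i < length xs")
    case True
    then have "ws ! i \<in> {src D (xs ! i), tgt D (xs ! i)}" "xs ! i \<in> arcs D"
      using adj[of i] xs(3) nth_mem by auto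
    then show ?thesis using ends by (auto simp: src_def tgt_def)
  next
    case False
    then have "i = length ws - 1" using that ws(1) by simp
    then have "ws ! i = src D e" using ws that by (metis last_conv_nth list.size(3) not_less_zero)
    then show ?thesis using ends e(1) by (simp add: src_def)
  qed
  then have "set (map fst ws) \<subseteq> verts D" by (metis image_subsetI in_set_conv_nth list.set_map)
  moreover have "{tail D (xs ! i), head D (xs ! i)} = {map fst ws ! i, map fst ws ! Suc i}"
    if "i < length xs" for i
    using fw[of i] bw[of i] that unfolding forward_def backward_def by (cases "even i") auto
  ultimately have "mwalk (underlying D) (map fst ws) xs"
    using ws xs by (simp add: mwalk_def underlying_def)
  moreover have "hd (map fst ws) = last (map fst ws)"
    using ws by (metis hd_conv_nth last_map list.map_disc_iff list.size(3) nat.distinct(1) nth_map zero_less_Suc)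
  moreover have "(forward D (map fst ws) xs i \<and> backward D (map fst ws) xs (Suc i)) \<or>
      (backward D (map fst ws) xs i \<and> forward D (map fst ws) xs (Suc i))" if "Suc i < length xs" for i
    using fw[of i] fw[of "Suc i"] bw[of i] bw[of "Suc i"] that by (cases "even i") auto
  ultimately have "closed_antidirected_trail D (map fst ws) xs"
    using xs \<open>even (length xs)\<close> by (simp add: closed_antidirected_trail_def)
  then show ?thesis by blast
qed

text \<open>The trail lifts to a closed trail of the double graph. As its arcs are distinct, all
  arcs but the last join the ends of the last one without using it.\<close>

lemma cycle_if_closed_antidirected_trail:
  assumes loopless: "\<And>e. e \<in> arcs D \<Longrightarrow> tail D e \<noteq> head D e"
    and cat: "closed_antidirected_trail D vs es"
  shows "\<exists>e\<in>arcs D. (src D e, tgt D e) \<in> conn (src D) (tgt D) (arcs D - {e})"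
proof -
  let ?n = "length es"
  have es: "es \<noteq> []" "even ?n" "distinct es" "set es \<subseteq> arcs D" "length vs = Suc ?n" "hd vs = last vs"
    and alt: "\<And>i. Suc i < ?n \<Longrightarrow> (forward D vs es i \<and> backward D vs es (Suc i)) \<or>
        (backward D vs es i \<and> forward D vs es (Suc i))"
    using cat by (auto simp: closed_antidirected_trail_def mwalk_def underlying_def)
  have n: "?n \<ge> 2" using es(1,2) by (cases es; cases "tl es") auto
  have excl: "\<not> (forward D vs es i \<and> backward D vs es i)" if "i < ?n" for i
    using loopless[OF subsetD[OF es(4) nth_mem[OF that]]] by (auto simp: forward_def backward_def)
  \<comment> \<open>The direction of the first arc fixes all tags: \<open>w i\<close> is tagged
    \<open>True\<close> exactly when arc \<open>i\<close> is traversed forward, that is, leaves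
    \<open>vs ! i\<close>.\<close>
  define b where "b = forward D vs es 0"
  define w where "w i = (vs ! i, b = even i)" for i
  have dir: "if b = even i then forward D vs es i else backward D vs es i" if "i < ?n" for i
    using that
  proof (induction i)
    case 0
    then show ?case using alt[of 0] n by (auto simp: b_def)
  next
    case (Suc i)
    then show ?case using alt[of i] excl[of i] by (auto split: if_splits)
  qed
  have adj: "{src D (es ! i), tgt D (es ! i)} = {w i, w (Suc i)}" if "i < ?n" for i
    using dir[OF that]
    by (auto simp: w_def src_def tgt_def forward_def backward_def split: if_splits)
  let ?e = "es ! (?n - 1)"
  let ?R = "conn (src D) (tgt D) (arcs D - {?e})"
  have path: "(w 0, w k) \<in> ?R" if "k \<le> ?n - 1" for k
    using that
  proof (induction k)
    case (Suc k)
    have "es ! k \<in> arcs D" using es(4) Suc.prems n by (meson diff_le_self less_le_trans nth_mem subsetD Suc_le_lessD)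
    moreover have "es ! k \<noteq> ?e" using es(3) Suc.prems by (simp add: nth_eq_iff_index_eq)
    ultimately have "es ! k \<in> arcs D - {?e}" by simp
    note edge = conn_edge[OF this, of "src D" "tgt D"]
    have "{src D (es ! k), tgt D (es ! k)} = {w k, w (Suc k)}" using Suc.prems by (intro adj) simp
    then have "(w k, w (Suc k)) \<in> ?R"
      using edge conn_sym[OF edge] by (auto simp: doubleton_eq_iff)
    then show ?case using Suc by (meson Suc_leD conn_trans)
  qed simp
  have "vs ! ?n = vs ! 0"
    using es(5,6) by (metis diff_Suc_1 hd_conv_nth last_conv_nth list.size(3) nat.distinct(1))
  \<comment> \<open>Even length brings the tag, and not only the vertex, back to its initial
    value.\<close>
  then have "w ?n = w 0" using es(2) by (simp add: w_def)
  moreover have "Suc (?n - 1) = ?n" using n by simp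
  ultimately have "{src D ?e, tgt D ?e} = {w (?n - 1), w 0}"
    using adj[of "?n - 1"] \<open>Suc (?n - 1) = ?n\<close> by (metis lessI)
  then have "(src D ?e, tgt D ?e) \<in> ?R"
    using path[of "?n - 1"] conn_sym[OF path[of "?n - 1"]] by (auto simp: doubleton_eq_iff)
  moreover have "?e \<in> arcs D" using es(1,4) by (metis last_conv_nth last_in_set subsetD)
  ultimately show ?thesis by blast
qed

section \<open>Necessity\<close>

context finite_loopless_multigraph
begin

lemma orientation_ends:
  assumes "orientation D G" "e \<in> arcs D"
  shows "tail D e \<in> verts D \<and> head D e \<in> verts D \<and> tail D e \<noteq> head D e"
  using assms mends_subset[of e] card_mends[of e] by (auto simp: orientation_def)

text \<open>The double graph restricted to \<open>H\<close> is a forest on twice as many vertices,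
  so edges plus components equal \<open>2 * card (mverts H)\<close>. There is at least one
  component, and at least two if \<open>H\<close> is bipartite.\<close>

lemma cat_free_sparse:
  assumes "has_cat_free_orientation G" and H: "msubgraph H G" "mverts H \<noteq> {}"
  shows "card (medges H) + (if mbipartite H then 2 else 1) \<le> 2 * card (mverts H)"
proof -
  obtain D where D: "orientation D G" and cat_free: "\<And>vs es. \<not> closed_antidirected_trail D vs es"
    using assms(1) by (auto simp: has_cat_free_orientation_def)
  let ?W = "mverts H \<times> (UNIV :: bool set)" and ?X = "medges H"
  have fin: "finite (mverts H)" "finite ?X" and X: "?X \<subseteq> arcs D"
    using H(1) D finite_mverts finite_medges
    by (auto simp: msubgraph_def orientation_def intro: finite_subset)
  have mends: "mends H e = {tail D e, head D e}" "mends H e \<subseteq> mverts H" if "e \<in> ?X" for e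
    using H(1) D that unfolding msubgraph_def orientation_def by (metis subsetD)+
  have ends: "src D e \<in> ?W \<and> tgt D e \<in> ?W" if "e \<in> ?X" for e
    using mends[OF that] by (auto simp: src_def tgt_def)
  have "(src D e, tgt D e) \<notin> conn (src D) (tgt D) (?X - {e})" if "e \<in> ?X" for e
  proof
    assume "(src D e, tgt D e) \<in> conn (src D) (tgt D) (?X - {e})"
    moreover have "?X - {e} \<subseteq> arcs D - {e}" using X by blast
    ultimately have "(src D e, tgt D e) \<in> conn (src D) (tgt D) (arcs D - {e})"
      using conn_mono by blast
    then show False
      using closed_antidirected_trail_if_cycle[of D e] orientation_ends[OF D] cat_free X that by blast
  qed
  then have "card (comps (src D) (tgt D) ?W ?X) + card ?X = card ?W"
    using fin ends by (intro card_comps_acyclic) auto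
  then have eq: "card (comps (src D) (tgt D) ?W ?X) + card ?X = 2 * card (mverts H)"
    by (simp add: card_cartesian_product)
  have finC: "finite (comps (src D) (tgt D) ?W ?X)" using fin by (simp add: finite_comps)
  moreover have "comps (src D) (tgt D) ?W ?X \<noteq> {}" using H(2) by (simp add: comps_def)
  ultimately have "card (comps (src D) (tgt D) ?W ?X) > 0" by (simp add: card_gt_0_iff)
  then have "card ?X + 1 \<le> 2 * card (mverts H)" using eq by simp
  moreover have "card ?X + 2 \<le> 2 * card (mverts H)" if bip: "mbipartite H"
  proof -
    from bip obtain A B where AB: "A \<union> B = mverts H" "A \<inter> B = {}"
      "\<forall>e\<in>?X. \<exists>a\<in>A. \<exists>b\<in>B. mends H e = {a, b}" unfolding mbipartite_def by (elim exE conjE)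
    \<comment> \<open>Each arc has its tail in \<open>A\<close> exactly when its head is in
      \<open>B\<close>, so no edge of the double graph leaves \<open>?S\<close>, whereas the two
      copies of a vertex lie on different sides of it.\<close>
    let ?S = "A \<times> {True} \<union> B \<times> {False}"
    obtain v where v: "v \<in> mverts H" using H(2) by blast
    have "src D e \<in> ?S \<longleftrightarrow> tgt D e \<in> ?S" if "e \<in> ?X" for e
      using AB(2) bspec[OF AB(3) that] mends(1)[OF that]
      by (auto simp: src_def tgt_def doubleton_eq_iff)
    then have "((v, True), (v, False)) \<notin> conn (src D) (tgt D) ?X"
      using conn_invariant[of "(v, True)" "(v, False)" "src D" "tgt D" ?X ?S] v AB(1,2) by auto
    then have "conn (src D) (tgt D) ?X `` {(v, True)} \<noteq> conn (src D) (tgt D) ?X `` {(v, False)}"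
      by (simp add: conn_class_eq_iff)
    then have "card {conn (src D) (tgt D) ?X `` {(v, True)}, conn (src D) (tgt D) ?X `` {(v, False)}} = 2"
      unfolding card_2_iff by blast
    moreover have "{conn (src D) (tgt D) ?X `` {(v, True)}, conn (src D) (tgt D) ?X `` {(v, False)}}
        \<subseteq> comps (src D) (tgt D) ?W ?X" using v by (auto simp only: comps_def)
    ultimately have "card (comps (src D) (tgt D) ?W ?X) \<ge> 2" using card_mono[OF finC] by metis
    then show ?thesis using eq by simp
  qed
  ultimately show ?thesis by simp
qed

end

section \<open>Sufficiency\<close>

text \<open>The edges of the double cover: \<open>(e, u, v)\<close> stands for the edge \<open>e\<close> directed from \<open>u\<close> to \<open>v\<close>.\<close>

definition lifts :: "('v, 'e) multigraph \<Rightarrow> 'e set \<Rightarrow> ('e \<times> 'v \<times> 'v) set" where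
  "lifts G J = {(e, u, v). e \<in> J \<and> mends G e = {u, v}}"

definition lift_src :: "'e \<times> 'v \<times> 'v \<Rightarrow> 'v \<times> bool" where
  "lift_src x = (fst (snd x), True)"

definition lift_tgt :: "'e \<times> 'v \<times> 'v \<Rightarrow> 'v \<times> bool" where
  "lift_tgt x = (snd (snd x), False)"

context finite_loopless_multigraph
begin

section \<open>Counting lifts in the double cover\<close>

lemma finite_lifts: "J \<subseteq> medges G \<Longrightarrow> finite (lifts G J)"
proof (rule finite_subset)
  assume "J \<subseteq> medges G"
  then show "lifts G J \<subseteq> medges G \<times> mverts G \<times> mverts G"
    using mends_subset by (auto simp: lifts_def)
qed (simp add: finite_mverts finite_medges)

lemma card_lifts:
  assumes "J \<subseteq> medges G"
  shows "card (lifts G J) = 2 * card J"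
proof -
  have fibre: "card {x \<in> lifts G J. fst x = e} = 2" if e: "e \<in> J" for e
  proof -
    obtain u v where uv: "mends G e = {u, v}" "u \<noteq> v"
      using card_mends[of e] e assms card_2_iff by (metis subsetD)
    then have "{x \<in> lifts G J. fst x = e} = {(e, u, v), (e, v, u)}"
      using e by (auto simp: lifts_def doubleton_eq_iff)
    then show ?thesis using uv(2) by simp
  qed
  have "finite J" using assms finite_medges finite_subset by blast
  have "lifts G J = (\<Union>e\<in>J. {x \<in> lifts G J. fst x = e})" by (auto simp: lifts_def)
  then have "card (lifts G J) = card (\<Union>e\<in>J. {x \<in> lifts G J. fst x = e})" by simp
  also have "\<dots> = (\<Sum>e\<in>J. card {x \<in> lifts G J. fst x = e})"
    using \<open>finite J\<close> finite_lifts[OF assms] by (intro card_UN_disjoint) auto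
  also have "\<dots> = 2 * card J" using fibre by simp
  finally show ?thesis .
qed

lemma lift_ends:
  assumes "J \<subseteq> medges G" "x \<in> lifts G J"
  shows "lift_src x \<in> mverts G \<times> UNIV \<and> lift_tgt x \<in> mverts G \<times> UNIV"
proof -
  obtain e u v where "x = (e, u, v)" "e \<in> J" "mends G e = {u, v}" using assms(2) by (auto simp: lifts_def)
  then show ?thesis
    using assms(1) mends_subset[of e] by (auto simp: lift_src_def lift_tgt_def)
qed

text \<open>Exchanging the copies of each vertex either preserves \<open>K\<close> or moves it off
  itself. If it preserves \<open>K\<close>, then \<open>K\<close> is the full double of its
  projection \<open>C\<close>, each edge contributes at most two lifts, and (i) suffices. Otherwise
  \<open>K\<close> projects injectively onto \<open>C\<close>, each edge contributes at most one
  lift, the tags give a bipartition, and (ii) applies.\<close>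

lemma card_lifts_component:
  assumes sparse: "\<And>H. msubgraph H G \<Longrightarrow> mverts H \<noteq> {} \<Longrightarrow> card (medges H) + 1 \<le> 2 * card (mverts H)"
    and bip_sparse: "\<And>H. msubgraph H G \<Longrightarrow> mverts H \<noteq> {} \<Longrightarrow> mbipartite H \<Longrightarrow>
      card (medges H) + 2 \<le> 2 * card (mverts H)"
    and J: "J \<subseteq> medges G"
    and K: "K \<in> comps lift_src lift_tgt (mverts G \<times> UNIV) (lifts G J)"
  shows "card {x \<in> lifts G J. lift_src x \<in> K} + 2 \<le> 2 * card K"
proof -
  let ?R = "conn lift_src lift_tgt (lifts G J)"
  let ?S = "{x \<in> lifts G J. lift_src x \<in> K}"
  obtain w where w: "w \<in> mverts G \<times> UNIV" "K = ?R `` {w}" using K by (auto simp: comps_def)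
  have edge: "(u, True) \<in> K \<longleftrightarrow> (v, False) \<in> K" if "e \<in> J" "mends G e = {u, v}" for e u v
  proof -
    have "(e, u, v) \<in> lifts G J" using that by (simp add: lifts_def)
    from conn_edge[OF this, of lift_src lift_tgt] have "((u, True), (v, False)) \<in> ?R"
      by (simp add: lift_src_def lift_tgt_def)
    then show ?thesis unfolding w(2) Image_singleton_iff by (meson conn_sym conn_trans)
  qed
  define swap :: "'v \<times> bool \<Rightarrow> 'v \<times> bool" where "swap a = (fst a, \<not> snd a)" for a
  have swap_swap: "swap (swap a) = a" for a by (simp add: swap_def)
  have swap_conn: "(swap a, swap b) \<in> ?R" if "(a, b) \<in> ?R" for a b
  proof (rule conn_automorphism[OF that])
    fix x assume "x \<in> lifts G J"
    then obtain e u v where "x = (e, u, v)" "(e, v, u) \<in> lifts G J"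
      by (auto simp: lifts_def insert_commute)
    then show "\<exists>y\<in>lifts G J. {swap (lift_src x), swap (lift_tgt x)} = {lift_src y, lift_tgt y}"
      by (intro bexI[of _ "(e, v, u)"]) (auto simp: swap_def lift_src_def lift_tgt_def)
  qed
  have KW: "K \<subseteq> mverts G \<times> UNIV"
  proof
    fix a assume "a \<in> K"
    then have "(w, a) \<in> ?R" using w(2) by simp
    from conn_invariant[OF this, of "mverts G \<times> UNIV"] show "a \<in> mverts G \<times> UNIV"
      using lift_ends[OF J] w(1) by blast
  qed
  then have finK: "finite K" by (rule finite_subset) (simp add: finite_mverts)
  \<comment> \<open>The hypotheses are applied to the graph formed by the projection of
    \<open>K\<close> and the edges of \<open>J\<close> inside it.\<close>
  define C where "C = fst ` K"
  define JC where "JC = {e \<in> J. mends G e \<subseteq> C}"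
  define H where "H = \<lparr>mverts = C, medges = JC, mends = mends G\<rparr>"
  have H: "msubgraph H G" "mverts H \<noteq> {}"
  proof -
    have "w \<in> K" using w by simp
    then show "msubgraph H G" "mverts H \<noteq> {}"
      using KW J by (auto simp: H_def msubgraph_def C_def JC_def)
  qed
  have finJC: "finite JC" "JC \<subseteq> medges G"
    using J finite_medges by (auto simp: JC_def intro: finite_subset)
  have endsC: "u \<in> C \<and> v \<in> C" if "(e, u, v) \<in> ?S" for e u v
    using that edge[of e u v] by (force simp: lifts_def lift_src_def C_def)
  show ?thesis
  proof (cases "swap w \<in> K")
    case True
    have "swap a \<in> K" if "a \<in> K" for a
      using that swap_conn[of w a] True unfolding w(2) Image_singleton_iff by (meson conn_trans)
    then have "(v, b) \<in> K" if v: "v \<in> C" for v b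
    proof -
      obtain b' where b': "(v, b') \<in> K" using v by (auto simp: C_def)
      show ?thesis
      proof (cases "b = b'")
        case False
        then have "swap (v, b') = (v, b)" by (auto simp: swap_def)
        then show ?thesis using \<open>\<And>a. a \<in> K \<Longrightarrow> swap a \<in> K\<close>[OF b'] by simp
      qed (use b' in simp)
    qed
    then have "K = C \<times> UNIV" by (auto simp: C_def rev_image_eqI)
    then have cardK: "card K = 2 * card C" by (metis card_UNIV_bool card_cartesian_product mult.commute)
    have "?S \<subseteq> lifts G JC"
      using endsC by (auto simp: lifts_def JC_def)
    then have "card ?S \<le> 2 * card JC"
      using card_mono[OF finite_lifts[OF finJC(2)], of ?S] by (simp add: card_lifts[OF finJC(2)])
    moreover have "card JC + 1 \<le> 2 * card C" using sparse[OF H] by (simp add: H_def)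
    ultimately show ?thesis using cardK by simp
  next
    case False
    \<comment> \<open>If \<open>a\<close> and \<open>swap a\<close> were both in \<open>K\<close>,
      exchanging copies on the walk from \<open>w\<close> to \<open>swap a\<close> would join
      \<open>swap w\<close> to \<open>a\<close> and put it into \<open>K\<close>.\<close>
    have disj: "swap a \<notin> K" if "a \<in> K" for a
      using that False swap_conn[of w "swap a"] unfolding w(2) Image_singleton_iff swap_swap
      by (meson conn_sym conn_trans)
    have "inj_on fst K"
    proof (rule inj_onI)
      fix a b assume "a \<in> K" "b \<in> K" "fst a = fst b"
      moreover have "b = swap a" if "a \<noteq> b"
        using that \<open>fst a = fst b\<close> by (auto simp: swap_def prod_eq_iff)
      ultimately show "a = b" using disj by blast
    qed
    then have cardC: "card C = card K" unfolding C_def by (rule card_image)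
    have "inj_on fst ?S"
    proof (rule inj_onI)
      fix x y assume xy: "x \<in> ?S" "y \<in> ?S" "fst x = fst y"
      obtain e u v where x: "x = (e, u, v)" by (cases x)
      obtain u' v' where y: "y = (e, u', v')" using xy(3) x by (cases y) simp
      have "{u, v} = {u', v'}" "e \<in> J" "mends G e = {u, v}" "(u, True) \<in> K" "(u', True) \<in> K"
        using xy x y by (auto simp: lifts_def lift_src_def)
      \<comment> \<open>If the second lift were the reverse of the first, both copies of
        \<open>v\<close> would lie in \<open>K\<close>.\<close>
      moreover have "u' \<noteq> v" using calculation edge[of e u v] disj[of "(v, True)"] by (auto simp: swap_def)
      ultimately show "x = y" using x y by (auto simp: doubleton_eq_iff)
    qed
    moreover have "fst ` ?S \<subseteq> JC"
      using endsC by (force simp: lifts_def JC_def)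
    ultimately have "card ?S \<le> card JC" by (rule card_inj_on_le[OF _ _ finJC(1)])
    moreover have "mbipartite H"
      unfolding mbipartite_def
    proof (intro exI conjI ballI)
      let ?A = "{v. (v, True) \<in> K}" and ?B = "{v. (v, False) \<in> K}"
      show "?A \<union> ?B = mverts H"
      proof -
        have "v \<in> ?A \<union> ?B" if "(v, b) \<in> K" for v b using that by (cases b) auto
        then show ?thesis by (force simp: H_def C_def)
      qed
      show "?A \<inter> ?B = {}" using disj by (force simp: swap_def)
      fix e assume "e \<in> medges H"
      then have e: "e \<in> J" "mends G e \<subseteq> C" by (auto simp: H_def JC_def)
      then obtain u v where uv: "mends G e = {u, v}" using card_mends[of e] J by (auto simp: card_2_iff)
      then obtain b where "(u, b) \<in> K" using e(2) by (auto simp: C_def)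
      then show "\<exists>a\<in>?A. \<exists>b\<in>?B. mends H e = {a, b}"
        using edge[of e u v] edge[of e v u] e(1) uv
        by (cases b) (auto simp: H_def insert_commute)
    qed
    then have "card JC + 2 \<le> 2 * card C" using bip_sparse[OF H] by (simp add: H_def)
    ultimately show ?thesis using cardC by simp
  qed
qed

text \<open>This is the Hall condition for Rado's theorem with the graphic rank. Summing the bounds
  over all components counts \<open>2 * card J\<close> lifts and gives twice the required
  inequality.\<close>

lemma lifts_rank:
  assumes sparse: "\<And>H. msubgraph H G \<Longrightarrow> mverts H \<noteq> {} \<Longrightarrow> card (medges H) + 1 \<le> 2 * card (mverts H)"
    and bip_sparse: "\<And>H. msubgraph H G \<Longrightarrow> mverts H \<noteq> {} \<Longrightarrow> mbipartite H \<Longrightarrow>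
      card (medges H) + 2 \<le> 2 * card (mverts H)"
    and J: "J \<subseteq> medges G"
  shows "card J + card (comps lift_src lift_tgt (mverts G \<times> UNIV) (lifts G J))
    \<le> card (mverts G \<times> (UNIV :: bool set))"
proof -
  let ?W = "mverts G \<times> (UNIV :: bool set)"
  let ?C = "comps lift_src lift_tgt ?W (lifts G J)"
  let ?S = "\<lambda>K. {x \<in> lifts G J. lift_src x \<in> K}"
  have finW: "finite ?W" using finite_mverts by simp
  have "lifts G J \<subseteq> (\<Union>K\<in>?C. ?S K)"
  proof
    fix x assume x: "x \<in> lifts G J"
    have "conn lift_src lift_tgt (lifts G J) `` {lift_src x} \<in> ?C"
      unfolding comps_def using conjunct1[OF lift_ends[OF J x]] by (rule imageI)
    moreover have "lift_src x \<in> conn lift_src lift_tgt (lifts G J) `` {lift_src x}" by auto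
    ultimately show "x \<in> (\<Union>K\<in>?C. ?S K)" using x by blast
  qed
  then have "card (lifts G J) \<le> card (\<Union>K\<in>?C. ?S K)"
    using finite_lifts[OF J] by (intro card_mono finite_subset[of "\<Union>K\<in>?C. ?S K" "lifts G J"]) auto
  also have "\<dots> \<le> (\<Sum>K\<in>?C. card (?S K))" by (rule card_UN_le[OF finite_comps[OF finW]])
  finally have "2 * card J \<le> (\<Sum>K\<in>?C. card (?S K))" using card_lifts[OF J] by simp
  moreover have "(\<Sum>K\<in>?C. card (?S K) + 2) \<le> (\<Sum>K\<in>?C. 2 * card K)"
    using card_lifts_component[OF sparse bip_sparse J] by (intro sum_mono) blast
  moreover have "(\<Sum>K\<in>?C. 2 * card K) = 2 * card ?W"
    using sum_card_comps[OF finW, of "lifts G J" lift_src lift_tgt] lift_ends[OF J]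
    by (simp flip: sum_distrib_left)
  moreover have "(\<Sum>K\<in>?C. card (?S K) + 2) = (\<Sum>K\<in>?C. card (?S K)) + 2 * card ?C"
    by (simp only: sum.distrib sum_constant mult.commute) simp
  ultimately show ?thesis by linarith
qed

lemma cat_free_if_sparse:
  assumes sparse: "\<And>H. msubgraph H G \<Longrightarrow> mverts H \<noteq> {} \<Longrightarrow> card (medges H) + 1 \<le> 2 * card (mverts H)"
    and bip_sparse: "\<And>H. msubgraph H G \<Longrightarrow> mverts H \<noteq> {} \<Longrightarrow> mbipartite H \<Longrightarrow>
      card (medges H) + 2 \<le> 2 * card (mverts H)"
  shows "has_cat_free_orientation G"
proof -
  let ?W = "mverts G \<times> (UNIV :: bool set)" and ?E = "medges G"
  let ?L = "lifts G ?E"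
  let ?c = "\<lambda>X. card (comps lift_src lift_tgt ?W X)"
  have finW: "finite ?W" using finite_mverts by simp
  have finL: "finite ?L" by (simp add: finite_lifts)
  have ends: "lift_src x \<in> ?W \<and> lift_tgt x \<in> ?W" if "x \<in> ?L" for x
    using lift_ends[OF order_refl that] by simp
  \<comment> \<open>Components never outnumber vertices, so the natural-number subtraction in the
    rank \<open>card ?W - ?c X\<close> is exact.\<close>
  have c_le: "?c X \<le> card ?W" for X by (rule card_comps_le[OF finW])
  have "\<exists>T\<subseteq>?L. bij_betw fst T ?E \<and> card ?E \<le> card ?W - ?c T"
  proof (rule rado[OF finL])
    show "fst ` ?L = ?E"
    proof (intro equalityI subsetI)
      fix e assume e: "e \<in> ?E"
      then obtain u v where "mends G e = {u, v}" using card_mends[of e] by (auto simp: card_2_iff)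
      then have "(e, u, v) \<in> ?L" using e by (simp add: lifts_def)
      then show "e \<in> fst ` ?L" by force
    qed (auto simp: lifts_def)
  next
    fix X Y assume "X \<subseteq> Y" "Y \<subseteq> ?L"
    then have "?c Y \<le> ?c X"
      using ends finite_subset[OF _ finL] by (intro card_comps_antimono[OF finW]) auto
    then show "card ?W - ?c X \<le> card ?W - ?c Y" by simp
  next
    fix X Y assume "X \<subseteq> ?L" "Y \<subseteq> ?L"
    then have "?c X + ?c Y \<le> ?c (X \<union> Y) + ?c (X \<inter> Y)"
      using ends finite_subset[OF _ finL] by (intro card_comps_supermodular[OF finW]) auto
    then show "(card ?W - ?c (X \<union> Y)) + (card ?W - ?c (X \<inter> Y)) \<le> (card ?W - ?c X) + (card ?W - ?c Y)"
      using c_le[of X] c_le[of Y] c_le[of "X \<union> Y"] c_le[of "X \<inter> Y"] by linarith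
  next
    fix J assume J: "J \<subseteq> ?E"
    then have "{x \<in> ?L. fst x \<in> J} = lifts G J" by (auto simp: lifts_def)
    then show "card J \<le> card ?W - ?c {x \<in> ?L. fst x \<in> J}"
      using lifts_rank[OF sparse bip_sparse J] by simp
  qed
  then obtain T where T: "T \<subseteq> ?L" "bij_betw fst T ?E" "card ?E \<le> card ?W - ?c T" by blast
  \<comment> \<open>\<open>s\<close> selects the lift of each edge that lies in the transversal
    \<open>T\<close>; its two end coordinates become tail and head.\<close>
  define s where "s = inv_into T fst"
  have sT: "s ` ?E = T" using bij_betw_imp_surj_on[OF bij_betw_inv_into[OF T(2)]] by (simp add: s_def)
  have fst_s: "fst (s e) = e" if "e \<in> ?E" for e
    using T(2) that unfolding s_def by (simp add: bij_betw_inv_into_right)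
  define D where "D = \<lparr>verts = mverts G, arcs = ?E,
    tail = (\<lambda>e. fst (snd (s e))), head = (\<lambda>e. snd (snd (s e)))\<rparr>"
  have "mends G e = {tail D e, head D e}" if "e \<in> ?E" for e
  proof -
    have "s e \<in> ?L" using sT T(1) that by blast
    then show ?thesis using fst_s[OF that] by (auto simp: lifts_def D_def)
  qed
  then have D: "orientation D G" by (simp add: orientation_def D_def)
  have st: "src D = lift_src \<circ> s" "tgt D = lift_tgt \<circ> s"
    by (auto simp: fun_eq_iff src_def tgt_def lift_src_def lift_tgt_def D_def)
  \<comment> \<open>The double graph of \<open>D\<close> is \<open>T\<close> with each lift renamed
    to its edge, so the rank bound on \<open>T\<close> makes it a forest.\<close>
  have "comps lift_src lift_tgt ?W T = comps (src D) (tgt D) ?W ?E"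
    by (simp add: comps_def st conn_image flip: sT)
  then have le: "card (comps (src D) (tgt D) ?W ?E) + card ?E \<le> card ?W"
    using T(3) c_le[of T] by simp
  have arcs: "arcs D = ?E" by (simp add: D_def)
  have "src D e \<in> ?W \<and> tgt D e \<in> ?W" if "e \<in> ?E" for e
    using ends[of "s e"] sT T(1) that by (auto simp: st)
  then have "(src D e, tgt D e) \<notin> conn (src D) (tgt D) (arcs D - {e})" if "e \<in> arcs D" for e
    using acyclic_if_card_comps[OF finW _ finite_medges le] that arcs by simp
  then have "\<not> closed_antidirected_trail D vs es" for vs es
    using cycle_if_closed_antidirected_trail[of D vs es] orientation_ends[OF D] by blast
  then show ?thesis using D by (auto simp: has_cat_free_orientation_def)
qed

end

lemma mbipartiteE:
  assumes "mbipartite H"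
  obtains A B where "A \<union> B = mverts H" "A \<inter> B = {}"
    "\<And>e. e \<in> medges H \<Longrightarrow> \<exists>a\<in>A. \<exists>b\<in>B. mends H e = {a, b}"
proof -
  from assms obtain A B where "A \<union> B = mverts H" "A \<inter> B = {}"
    "\<And>e. e \<in> medges H \<Longrightarrow> \<exists>a\<in>A. \<exists>b\<in>B. mends H e = {a, b}" by (auto simp: mbipartite_def)
  then show thesis by (rule that)
qed

theorem theorem6p3:
  fixes G :: "('v, 'e) multigraph"
  assumes "finite_loopless_multigraph G"
  shows "(has_cat_free_orientation G \<longleftrightarrow>
      (\<forall>H. msubgraph H G \<and> mverts H \<noteq> {} \<longrightarrow>
         int (card (medges H)) \<le> 2 * int (card (mverts H)) - 1) \<and>
      (\<forall>H. msubgraph H G \<and> mverts H \<noteq> {} \<and> mbipartite H \<longrightarrow>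
         int (card (medges H)) \<le> 2 * int (card (mverts H)) - 2)) \<and>
    (\<forall>n\<ge>1. card (mverts G) = n \<and> card (medges G) \<ge> 2 * n \<longrightarrow>
      \<not> has_cat_free_orientation G) \<and>
    (\<forall>n\<ge>1. card (mverts G) = n \<and> mbipartite G \<and> card (medges G) \<ge> 2 * n - 1 \<longrightarrow>
      \<not> has_cat_free_orientation G)"
proof -
  have sparse: "card (medges H) + 1 \<le> 2 * card (mverts H)"
    and bip_sparse: "mbipartite H \<Longrightarrow> card (medges H) + 2 \<le> 2 * card (mverts H)"
    if "has_cat_free_orientation G" "msubgraph H G" "mverts H \<noteq> {}" for H
    using finite_loopless_multigraph.cat_free_sparse[OF assms that] by (simp_all split: if_splits)
  note sufficiency = finite_loopless_multigraph.cat_free_if_sparse[OF assms]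
  \<comment> \<open>The two concluding claims about \<open>G\<close> come from applying the sparsity
    bounds to \<open>G\<close> as its own subgraph.\<close>
  have G: "msubgraph G G"
    using finite_loopless_multigraph.mends_subset[OF assms] by (simp add: msubgraph_def)
  have nonempty: "mverts G \<noteq> {}" if "card (mverts G) \<ge> 1" using that by auto
  have iff: "int (card (medges H)) \<le> 2 * int (card (mverts H)) - 1 \<longleftrightarrow>
      card (medges H) + 1 \<le> 2 * card (mverts H)"
    "int (card (medges H)) \<le> 2 * int (card (mverts H)) - 2 \<longleftrightarrow>
      card (medges H) + 2 \<le> 2 * card (mverts H)" for H :: "('v, 'e) multigraph"
    by linarith+
  have "has_cat_free_orientation G \<longleftrightarrow>
      (\<forall>H. msubgraph H G \<and> mverts H \<noteq> {} \<longrightarrow> card (medges H) + 1 \<le> 2 * card (mverts H)) \<and>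
      (\<forall>H. msubgraph H G \<and> mverts H \<noteq> {} \<and> mbipartite H \<longrightarrow>
         card (medges H) + 2 \<le> 2 * card (mverts H))"
    using sparse bip_sparse sufficiency by blast
  moreover have "\<not> has_cat_free_orientation G"
    if "card (mverts G) \<ge> 1" "card (medges G) \<ge> 2 * card (mverts G)"
    using sparse[OF _ G nonempty[OF that(1)]] that by fastforce
  moreover have "\<not> has_cat_free_orientation G"
    if "card (mverts G) \<ge> 1" "mbipartite G" "card (medges G) \<ge> 2 * card (mverts G) - 1"
    using bip_sparse[OF _ G nonempty[OF that(1)] that(2)] that by fastforce
  ultimately show ?thesis unfolding iff by blast
qed

end
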